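(* Let $a,b\ge 1$ be real numbers, let $\mu_W$ be the Wachter law with parameters $a,b$, and let $m_k=\int x^k\,d\mu_W(x)$ denote its $k$-th moment. Then for every integer $k\ge 1$, $$ m_k = \frac{a}{a+b} - (a+b)\sum_{j=0}^{k-2}\left[\left(\frac{\sqrt{a(a+b-1)}}{a+b}\right)^{2j+4}N_{j+1}\left(\frac{b}{a(a+b-1)}\right)\right],$$ where $N_n$ denotes the $n$-th Narayana polynomial and the sum is empty (equal to $0$) when $k=1$.
   Context: For real $a,b\ge 1$, the Wachter law $\mu_W$ is the probability measure supported on the interval $[\mu_-,\mu_+]$, where $$\mu_{\pm}=\left(\frac{\sqrt{b}\pm\sqrt{a(a+b-1)}}{a+b}\right)^2,$$ with density $$ d\mu_W(x)=\frac{(a+b)\sqrt{(\mu_+-x)(x-\mu_-)}}{2\pi x(1-x)}\,dx,\qquad x\in[\mu_-,\mu_+].$$ The Narayana polynomials are defined for integers $n\ge 1$ by $$N_n(r)=\sum_{j=1}^{n}N_{n,j}\,r^j,\qquad N_{n,j}=\frac1n\binom{n}{j}\binom{n}{j-1},$$ and $N_0(r)=1$. *)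

theory Defs
  imports "HOL-Probability.Probability" "HOL-Computational_Algebra.Polynomial"
begin

definition wachter_lower :: "real \<Rightarrow> real \<Rightarrow> real" where
  "wachter_lower a b = ((sqrt b - sqrt (a * (a + b - 1))) / (a + b))\<^sup>2"

definition wachter_upper :: "real \<Rightarrow> real \<Rightarrow> real" where
  "wachter_upper a b = ((sqrt b + sqrt (a * (a + b - 1))) / (a + b))\<^sup>2"

text \<open>When \<open>a = 1\<close> the lower edge is \<open>0\<close>, and when \<open>b = 1\<close> the upper edge is \<open>1\<close>. At such an
  endpoint the quotient below is \<open>0\<close> by the convention on division by zero, which only concerns a
  null set.\<close>

definition wachter_density :: "real \<Rightarrow> real \<Rightarrow> real \<Rightarrow> real" where
  "wachter_density a b x =
     indicator {wachter_lower a b..wachter_upper a b} x *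
     ((a + b) * sqrt ((wachter_upper a b - x) * (x - wachter_lower a b)) / (2 * pi * x * (1 - x)))"

definition wachter_law :: "real \<Rightarrow> real \<Rightarrow> real measure" where
  "wachter_law a b = density lborel (\<lambda>x. ennreal (wachter_density a b x))"

definition narayana_number :: "nat \<Rightarrow> nat \<Rightarrow> real" where
  "narayana_number n j = 1 / real n * real (n choose j) * real (n choose (j - 1))"

definition narayana_poly :: "nat \<Rightarrow> real poly" where
  "narayana_poly n = (if n = 0 then 1 else (\<Sum>j = 1..n. monom (narayana_number n j) j))"

end

theory Submission imports Defs begin

text \<open>
  Put \<open>s = a + b\<close>, \<open>u = sqrt b / s\<close> and \<open>v = sqrt (a (a + b - 1)) / s\<close>, so that the support
  of the Wachter law is \<open>[(u - v)\<^sup>2, (u + v)\<^sup>2]\<close>. Multiplying the density by \<open>1 - x\<close> removes one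
  factor of its denominator, hence \<open>m\<^sub>k - m\<^sub>k\<^sub>+\<^sub>1\<close> is \<open>s\<close> times the \<open>(k - 1)\<close>-st moment of a semicircle.
  Under \<open>x = u\<^sup>2 + v\<^sup>2 - 2 u v cos t\<close>, i.e. \<open>x = |u - v exp (i t)|\<^sup>2\<close>, this moment is read off
  the binomial expansion of \<open>(u - v exp (i t))\<^sup>m\<close>: the weight \<open>sin\<^sup>2 t\<close> only sees frequencies
  \<open>0\<close> and \<open>\<plusminus>2\<close>, and what survives are the differences
  \<open>(m choose j)\<^sup>2 - (m choose (j - 1)) (m choose (j + 1))\<close>, which are Narayana numbers.
  The recursion starts from \<open>m\<^sub>1\<close>, an elementary integral with an arctangent primitive.
\<close>

section \<open>Narayana numbers through binomial coefficients\<close>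

lemma narayana_number_Suc_0: "narayana_number (Suc m) (Suc 0) = 1"
  by (simp add: narayana_number_def)

text \<open>By Pascal's rule the two binomials in the Narayana number are \<open>X + Y\<close> and
  \<open>Y + Z\<close>, with \<open>X\<close>, \<open>Y\<close>, \<open>Z\<close> consecutive in row
  \<open>m\<close>. Absorption ties \<open>X\<close> to \<open>Y\<close> and \<open>Y\<close> to
  \<open>Z\<close>.\<close>

lemma narayana_number_Suc_Suc:
  "narayana_number (Suc m) (Suc (Suc j)) =
    real (m choose Suc j) ^ 2 - real (m choose j) * real (m choose Suc (Suc j))"
proof -
  have absorb: "(real i + 1) * real (m choose Suc i) = (real m - real i) * real (m choose i)" for i
  proof (cases "i \<le> m")
    case True
    have "Suc i * (m choose Suc i) = (m - i) * (m choose i)"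
      by (simp only: binomial_absorb_comp binomial_absorption)
    then have "real (Suc i * (m choose Suc i)) = real ((m - i) * (m choose i))"
      by (rule arg_cong)
    then show ?thesis using True by (simp add: of_nat_diff algebra_simps)
  qed (simp add: binomial_eq_0)
  define X Y Z where "X = real (m choose j)" and "Y = real (m choose Suc j)"
    and "Z = real (m choose Suc (Suc j))"
  have XY: "(real j + 1) * Y = (real m - real j) * X"
    using absorb[of j] by (simp add: X_def Y_def)
  have YZ: "(real j + 2) * Z = (real m - real j - 1) * Y"
    using absorb[of "Suc j"] by (simp add: Y_def Z_def algebra_simps)
  \<comment> \<open>The factor \<open>real j + 2\<close> is what \<open>YZ\<close> needs to turn
    \<open>Y + Z\<close> into a multiple of \<open>Y\<close>.\<close>
  have "(real j + 2) * ((X + Y) * (Y + Z)) = (X + Y) * ((real m + 1) * Y)"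
    using YZ by algebra
  also have "\<dots> = (real j + 2) * ((real m + 1) * (Y ^ 2 - X * Z))"
    using XY YZ by algebra
  finally have "(X + Y) * (Y + Z) = (real m + 1) * (Y ^ 2 - X * Z)"
    by simp
  then show ?thesis
    unfolding narayana_number_def X_def Y_def Z_def by (simp add: field_simps)
qed

section \<open>Trigonometric integrals for the semicircle moments\<close>

text \<open>The base is the squared modulus of \<open>u * cis t + v\<close>, so its
  \<open>m\<close>-th power is a product of two binomial expansions, at \<open>t\<close> and at
  \<open>- t\<close>. Taking real parts turns \<open>cis\<close> into \<open>cos\<close>.\<close>

lemma power_cos_expansion:
  fixes u v t :: real and m :: nat
  defines "A \<equiv> \<lambda>k. real (m choose k) * u ^ k * v ^ (m - k)"
  shows "(u\<^sup>2 + v\<^sup>2 + 2 * u * v * cos t) ^ m =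
    (\<Sum>k\<le>m. \<Sum>l\<le>m. A k * A l * cos ((real k - real l) * t))"
proof -
  have expand: "(of_real u * cis x + of_real v) ^ m = (\<Sum>k\<le>m. of_real (A k) * cis (real k * x))" for x
  proof -
    have "(of_real u * cis x) ^ k = of_real (u ^ k) * cis (real k * x)" for k
      by (simp only: power_mult_distrib Complex.DeMoivre of_real_power)
    then show ?thesis
      unfolding binomial_ring A_def by (intro sum.cong refl) simp
  qed
  have "of_real (u\<^sup>2 + v\<^sup>2 + 2 * u * v * cos t) =
      (of_real u * cis t + of_real v) * (of_real u * cis (- t) + of_real v :: complex)"
  proof (rule complex_eqI)
    show "Re (of_real (u\<^sup>2 + v\<^sup>2 + 2 * u * v * cos t)) =
        Re ((of_real u * cis t + of_real v) * (of_real u * cis (- t) + of_real v))"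
    proof -
      have "u\<^sup>2 + v\<^sup>2 + 2 * u * v * cos t = (u * cos t + v)\<^sup>2 + (u * sin t)\<^sup>2"
        using sin_cos_squared_add[of t] by algebra
      then show ?thesis by (simp add: power2_eq_square)
    qed
  qed (simp add: algebra_simps)
  then have "of_real ((u\<^sup>2 + v\<^sup>2 + 2 * u * v * cos t) ^ m) =
      (\<Sum>k\<le>m. of_real (A k) * cis (real k * t)) * (\<Sum>l\<le>m. of_real (A l) * cis (real l * - t))"
    by (simp only: of_real_power power_mult_distrib expand)
  also have "\<dots> = (\<Sum>k\<le>m. \<Sum>l\<le>m. of_real (A k * A l) * cis ((real k - real l) * t))"
  proof -
    have "cis ((real k - real l) * t) = cis (real k * t) * cis (real l * - t)" for k l
      by (simp add: cis_mult left_diff_distrib)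
    then show ?thesis unfolding sum_product by (simp add: mult_ac)
  qed
  finally have "Re (of_real ((u\<^sup>2 + v\<^sup>2 + 2 * u * v * cos t) ^ m)) = Re \<dots>"
    by (rule arg_cong)
  then show ?thesis by simp
qed

lemma has_integral_cos_int:
  "((\<lambda>t. cos (of_int n * t)) has_integral (if n = 0 then pi else 0)) {0..pi}"
proof (cases "n = 0")
  case True
  then show ?thesis using has_integral_const_real[of "1::real" 0 pi] by simp
next
  case False
  have "((\<lambda>t. cos (of_int n * t)) has_integral
      sin (of_int n * pi) / of_int n - sin (of_int n * 0) / of_int n) {0..pi}"
    using False
    by (intro fundamental_theorem_of_calculus)
      (auto intro!: derivative_eq_intros simp flip: has_real_derivative_iff_has_vector_derivative)
  then show ?thesis using False by (simp add: sin_zero_iff_int2 mult.commute)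
qed

text \<open>With \<open>d = k - l\<close>, the product is
  \<open>cos (d t) / 2 - cos ((d + 2) t) / 4 - cos ((d - 2) t) / 4\<close>, and a cosine of nonzero
  integer frequency integrates to 0 over \<open>{0..pi}\<close>.\<close>

lemma has_integral_cos_times_sin_squared:
  "((\<lambda>t. cos ((real k - real l) * t) * (sin t)\<^sup>2) has_integral
    pi / 4 * (2 * of_bool (k = l) - of_bool (l = k + 2) - of_bool (k = l + 2))) {0..pi}"
proof -
  define d where "d = int k - int l"
  let ?I = "\<lambda>n::int. if n = 0 then pi else 0"
  have "((\<lambda>t. cos (of_int d * t) / 2 - cos (of_int (d + 2) * t) / 4 - cos (of_int (d - 2) * t) / 4)
      has_integral ?I d / 2 - ?I (d + 2) / 4 - ?I (d - 2) / 4) {0..pi}"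
    by (intro has_integral_diff has_integral_divide has_integral_cos_int)
  also have "(\<lambda>t. cos (of_int d * t) / 2 - cos (of_int (d + 2) * t) / 4 - cos (of_int (d - 2) * t) / 4) =
      (\<lambda>t::real. cos (of_int d * t) * (sin t)\<^sup>2)"
  proof
    fix t :: real
    have "cos (of_int (d + 2) * t) + cos (of_int (d - 2) * t) = 2 * cos (of_int d * t) * cos (2 * t)"
      by (simp add: distrib_right left_diff_distrib cos_add cos_diff)
    also have "\<dots> = 2 * cos (of_int d * t) - 4 * (cos (of_int d * t) * (sin t)\<^sup>2)"
      by (simp only: cos_double_sin) (simp add: algebra_simps)
    finally show "cos (of_int d * t) / 2 - cos (of_int (d + 2) * t) / 4 - cos (of_int (d - 2) * t) / 4 =
        cos (of_int d * t) * (sin t)\<^sup>2"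
      by simp
  qed
  finally show ?thesis
    by (rule has_integral_eq_rhs[OF has_integral_cong[THEN iffD1, rotated]])
      (auto simp: d_def field_simps)
qed

text \<open>Only the diagonal and the two off-diagonals at distance 2 of the double sum survive, the
  latter being equal by symmetry. Since \<open>A (j - 1) * A (j + 1)\<close> carries the same powers
  of \<open>u\<close> and \<open>v\<close> as \<open>A j * A j\<close>, their difference is a
  Narayana number times a monomial.\<close>

lemma has_integral_semicircle_moment:
  fixes u v :: real and m :: nat
  shows "((\<lambda>t. (u\<^sup>2 + v\<^sup>2 + 2 * u * v * cos t) ^ m * (sin t)\<^sup>2) has_integral
    pi / 2 * (\<Sum>j\<le>m. narayana_number (Suc m) (Suc j) * u ^ (2 * j) * v ^ (2 * (m - j)))) {0..pi}"
proof -
  define A where "A k = real (m choose k) * u ^ k * v ^ (m - k)" for k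
  have A_0: "A k = 0" if "k > m" for k
    using that by (simp add: A_def binomial_eq_0)
  define S where "S = (\<Sum>k\<le>m. A k * A (k + 2))"
  have shift1: "(\<Sum>l\<le>m. A k * A l * of_bool (l = k + 2)) = A k * A (k + 2)" for k
  proof -
    have "(\<Sum>l\<le>m. A k * A l * of_bool (l = k + 2)) = (\<Sum>l\<le>m. if l = k + 2 then A k * A l else 0)"
      by (intro sum.cong) auto
    then show ?thesis by (simp add: A_0)
  qed
  have diag: "(\<Sum>l\<le>m. A k * A l * of_bool (k = l)) = A k * A k" if "k \<le> m" for k
  proof -
    have "(\<Sum>l\<le>m. A k * A l * of_bool (k = l)) = (\<Sum>l\<le>m. if l = k then A k * A l else 0)"
      by (intro sum.cong) auto
    then show ?thesis using that by simp
  qed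
  have S2: "(\<Sum>k\<le>m. \<Sum>l\<le>m. A k * A l * of_bool (k = l + 2)) = S"
    by (subst sum.swap) (use shift1 in \<open>simp add: S_def mult.commute\<close>)
  have "(\<Sum>k\<le>m. \<Sum>l\<le>m. A k * A l *
      (pi / 4 * (2 * of_bool (k = l) - of_bool (l = k + 2) - of_bool (k = l + 2)))) =
    pi / 4 * (2 * (\<Sum>k\<le>m. \<Sum>l\<le>m. A k * A l * of_bool (k = l)) -
      (\<Sum>k\<le>m. \<Sum>l\<le>m. A k * A l * of_bool (l = k + 2)) -
      (\<Sum>k\<le>m. \<Sum>l\<le>m. A k * A l * of_bool (k = l + 2)))"
    by (simp add: sum_distrib_left sum_subtractf sum.distrib algebra_simps)
  also have "\<dots> = pi / 2 * ((\<Sum>k\<le>m. A k * A k) - S)"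
    by (simp only: shift1 S2) (simp add: diag S_def)
  \<comment> \<open>The index moves up by one so that each product lines up with the square of its
    middle term; the \<open>0\<close> entry matches the first Narayana number, which has no
    correction term.\<close>
  also have "S = (\<Sum>k\<le>m. case k of 0 \<Rightarrow> 0 | Suc i \<Rightarrow> A i * A (i + 2))"
  proof (cases m)
    case 0
    then show ?thesis by (simp add: S_def A_0)
  next
    case (Suc m')
    have "S = (\<Sum>k\<le>m'. A k * A (k + 2))"
      unfolding S_def Suc using A_0[of "Suc m' + 2"] Suc by simp
    then show ?thesis unfolding Suc sum.atMost_Suc_shift by simp
  qed
  also have "(\<Sum>k\<le>m. A k * A k) - \<dots> =
      (\<Sum>j\<le>m. narayana_number (Suc m) (Suc j) * u ^ (2 * j) * v ^ (2 * (m - j)))"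
    unfolding sum_subtractf[symmetric]
  proof (intro sum.cong refl)
    fix j assume j: "j \<in> {..m}"
    show "A j * A j - (case j of 0 \<Rightarrow> 0 | Suc i \<Rightarrow> A i * A (i + 2)) =
        narayana_number (Suc m) (Suc j) * u ^ (2 * j) * v ^ (2 * (m - j))"
    proof (cases j)
      case 0
      then show ?thesis by (simp add: A_def narayana_number_Suc_0 mult_2 power_add)
    next
      case (Suc i)
      have sq: "A j * A j = real (m choose j) ^ 2 * u ^ (2 * j) * v ^ (2 * (m - j))"
        by (simp only: A_def power_even_eq) (simp add: power2_eq_square mult_ac)
      have "A i * A (i + 2) =
          real (m choose i) * real (m choose Suc j) * u ^ (2 * j) * v ^ (2 * (m - j))"
      \<comment> \<open>The exponent \<open>m - (i + 2)\<close> is a truncated difference, so the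
        powers of \<open>v\<close> add up only in this range; beyond it both sides are 0.\<close>
      proof (cases "Suc j \<le> m")
        case True
        then have "u ^ i * u ^ (i + 2) = u ^ (2 * j)"
          "v ^ (m - i) * v ^ (m - (i + 2)) = v ^ (2 * (m - j))"
          unfolding power_add[symmetric] using Suc
          by (auto intro!: arg_cong[where f = "\<lambda>n. _ ^ n"])
        moreover have "A i * A (i + 2) = real (m choose i) * real (m choose Suc j) *
            (u ^ i * u ^ (i + 2)) * (v ^ (m - i) * v ^ (m - (i + 2)))"
          by (simp only: A_def Suc add_2_eq_Suc' mult_ac)
        ultimately show ?thesis by (simp only:)
      next
        case False
        then show ?thesis using A_0[of "i + 2"] Suc by (simp add: binomial_eq_0)
      qed
      then show ?thesis
        by (simp add: Suc sq[unfolded Suc] narayana_number_Suc_Suc algebra_simps)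
    qed
  qed
  finally have total: "(\<Sum>k\<le>m. \<Sum>l\<le>m. A k * A l *
      (pi / 4 * (2 * of_bool (k = l) - of_bool (l = k + 2) - of_bool (k = l + 2)))) =
    pi / 2 * (\<Sum>j\<le>m. narayana_number (Suc m) (Suc j) * u ^ (2 * j) * v ^ (2 * (m - j)))" .
  have "((\<lambda>t. \<Sum>k\<le>m. \<Sum>l\<le>m. A k * A l * (cos ((real k - real l) * t) * (sin t)\<^sup>2))
      has_integral (\<Sum>k\<le>m. \<Sum>l\<le>m. A k * A l *
      (pi / 4 * (2 * of_bool (k = l) - of_bool (l = k + 2) - of_bool (k = l + 2))))) {0..pi}"
    by (intro has_integral_sum finite_atMost has_integral_mult_right has_integral_cos_times_sin_squared)
  also have "(\<lambda>t. \<Sum>k\<le>m. \<Sum>l\<le>m. A k * A l * (cos ((real k - real l) * t) * (sin t)\<^sup>2)) =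
      (\<lambda>t. (u\<^sup>2 + v\<^sup>2 + 2 * u * v * cos t) ^ m * (sin t)\<^sup>2)"
    unfolding power_cos_expansion A_def by (simp only: sum_distrib_right mult.assoc)
  finally show ?thesis unfolding total .
qed

section \<open>The integral behind the first moment\<close>

text \<open>Division by \<open>e + R * cos t\<close> leaves \<open>e - R * cos t\<close> and a
  multiple of its reciprocal, whose integral over \<open>{0..pi}\<close> is \<open>pi / D\<close>
  when \<open>D > 0\<close>.\<close>

lemma has_integral_sin_squared_div:
  fixes e R D :: real
  assumes "R > 0" "D \<ge> 0" "e > 0" and e2: "e\<^sup>2 = R\<^sup>2 + D\<^sup>2"
  shows "((\<lambda>t. R\<^sup>2 * (sin t)\<^sup>2 / (e + R * cos t)) has_integral pi * (e - D)) {0..pi}"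
proof -
  have split: "R\<^sup>2 * (sin t)\<^sup>2 / (e + R * cos t) = e - R * cos t - D\<^sup>2 / (e + R * cos t)"
    if "e + R * cos t \<noteq> 0" for t
  proof -
    have "R\<^sup>2 * (sin t)\<^sup>2 = (e - R * cos t) * (e + R * cos t) - D\<^sup>2"
      using e2 sin_cos_squared_add[of t] by algebra
    then show ?thesis using that by (simp add: diff_divide_distrib)
  qed
  show ?thesis
  \<comment> \<open>Here \<open>e = R\<close> and the denominator vanishes at \<open>pi\<close>, so
    the primitive is differentiated only in the interior.\<close>
  proof (cases "D = 0")
    case True
    then have eR: "e = R" using e2 assms by simp
    have "((\<lambda>t. R\<^sup>2 * (sin t)\<^sup>2 / (e + R * cos t)) has_integral
        (e * pi - R * sin pi) - (e * 0 - R * sin 0)) {0..pi}"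
    proof (rule fundamental_theorem_of_calculus_interior)
      fix t :: real assume t: "t \<in> {0<..<pi}"
      then have "cos t > - 1" using cos_monotone_0_pi[of t pi] by simp
      then have "R * (- 1) < R * cos t" using \<open>R > 0\<close> by (intro mult_strict_left_mono)
      then have "e + R * cos t \<noteq> 0" using eR by simp
      then show "((\<lambda>t. e * t - R * sin t) has_vector_derivative
          R\<^sup>2 * (sin t)\<^sup>2 / (e + R * cos t)) (at t)"
        unfolding has_real_derivative_iff_has_vector_derivative[symmetric]
        by (auto simp: split True intro!: derivative_eq_intros)
    qed (auto intro!: continuous_intros)
    then show ?thesis using True by (simp add: mult.commute)
  next
    case False
    then have D: "D > 0" using assms by simp
    then have "R\<^sup>2 < e\<^sup>2" unfolding e2 by simp
    then have "R < e" by (rule power2_less_imp_less) (use \<open>e > 0\<close> in simp)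
    have pos: "e + R * cos t > 0" for t
    proof -
      have "R * (- 1) \<le> R * cos t" using \<open>R > 0\<close> by (intro mult_left_mono) auto
      then show ?thesis using \<open>R < e\<close> by simp
    qed
    \<comment> \<open>Writing \<open>e + R cos t = |\<alpha> + \<beta> exp (i t)|\<^sup>2\<close> with \<open>D = \<alpha>\<^sup>2 - \<beta>\<^sup>2\<close>, the arctangent is the
      argument of \<open>\<alpha> + \<beta> exp (i t)\<close>. Unlike the half-angle primitive it is smooth at \<open>pi\<close>.\<close>
    define F where "F t = e * t - R * sin t - D * (t - 2 * arctan (R * sin t / (e + D + R * cos t)))" for t
    have "((\<lambda>t. R\<^sup>2 * (sin t)\<^sup>2 / (e + R * cos t)) has_integral F pi - F 0) {0..pi}"
    proof (rule fundamental_theorem_of_calculus)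
      fix t :: real
      define y where "y = e + D + R * cos t"
      have y: "y > 0" using pos[of t] D by (simp add: y_def)
      \<comment> \<open>Both \<open>y2\<close> and \<open>num\<close> contain the factor
        \<open>e + D\<close>, which cancels in the derivative of the arctangent.\<close>
      have y2: "y\<^sup>2 + (R * sin t)\<^sup>2 = 2 * (e + D) * (e + R * cos t)"
        using e2 sin_cos_squared_add[of t] unfolding y_def by algebra
      define q where "q = (R * cos t * y + R * sin t * (R * sin t)) / y\<^sup>2"
      have num: "R * cos t * y + R * sin t * (R * sin t) = (e + D) * (R * cos t + e - D)"
        using e2 sin_cos_squared_add[of t] unfolding y_def by algebra
      have "((\<lambda>t. R * sin t / (e + D + R * cos t)) has_real_derivative q) (at t)"
        using y unfolding q_def y_def
        by (auto intro!: derivative_eq_intros simp: power2_eq_square)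
      then have arc: "((\<lambda>t. arctan (R * sin t / (e + D + R * cos t))) has_real_derivative
          inverse (1 + (R * sin t / y)\<^sup>2) * q) (at t)"
        unfolding y_def by (rule DERIV_chain2[OF DERIV_arctan])
      have "inverse (1 + (R * sin t / y)\<^sup>2) * q =
          (R * cos t * y + R * sin t * (R * sin t)) / (y\<^sup>2 + (R * sin t)\<^sup>2)"
      proof -
        have "1 + (R * sin t / y)\<^sup>2 = (y\<^sup>2 + (R * sin t)\<^sup>2) / y\<^sup>2"
          using y by (simp add: field_simps)
        then show ?thesis using y by (simp add: q_def)
      qed
      also have "\<dots> = (R * cos t + e - D) / (2 * (e + R * cos t))"
        unfolding y2 num using D \<open>e > 0\<close>
          nonzero_mult_divide_mult_cancel_left[of "e + D" "R * cos t + e - D" "2 * (e + R * cos t)"]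
        by (simp only: mult.assoc mult.left_commute[of 2])
      finally have arc_val: "inverse (1 + (R * sin t / y)\<^sup>2) * q = \<dots>" .
      have "(F has_real_derivative e * 1 - R * cos t - D * (1 - 2 * ((R * cos t + e - D) / (2 * (e + R * cos t))))) (at t)"
        unfolding F_def
        by (intro DERIV_diff DERIV_cmult DERIV_ident DERIV_sin arc[unfolded arc_val])
      also have "e * 1 - R * cos t - D * (1 - 2 * ((R * cos t + e - D) / (2 * (e + R * cos t)))) =
          R\<^sup>2 * (sin t)\<^sup>2 / (e + R * cos t)"
      proof -
        have "2 * ((R * cos t + e - D) / (2 * (e + R * cos t))) = 1 - D / (e + R * cos t)"
          using pos[of t] by (simp add: field_simps)
        then have "e * 1 - R * cos t - D * (1 - 2 * ((R * cos t + e - D) / (2 * (e + R * cos t)))) =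
            e - R * cos t - D\<^sup>2 / (e + R * cos t)"
          by (simp only:) (simp add: power2_eq_square)
        then show ?thesis
          using pos[of t] split[of t] by simp
      qed
      finally show "(F has_vector_derivative R\<^sup>2 * (sin t)\<^sup>2 / (e + R * cos t)) (at t within {0..pi})"
        unfolding has_real_derivative_iff_has_vector_derivative[symmetric]
        by (rule has_field_derivative_at_within)
    qed simp
    then show ?thesis by (simp add: F_def algebra_simps)
  qed
qed

text \<open>This clears the powers of \<open>v\<close> from the denominators, giving the sum in the
  semicircle moment; its prefactor is \<open>R\<^sup>2 / 4\<close> for the half-width
  \<open>R = 2 * u * v\<close> of the support.\<close>

lemma narayana_poly_homogeneous:
  fixes u v :: real
  assumes "v \<noteq> 0"
  shows "v ^ (2 * m + 4) * poly (narayana_poly (Suc m)) (u\<^sup>2 / v\<^sup>2) =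
    u\<^sup>2 * v\<^sup>2 * (\<Sum>j\<le>m. narayana_number (Suc m) (Suc j) * u ^ (2 * j) * v ^ (2 * (m - j)))"
proof -
  have "poly (narayana_poly (Suc m)) (u\<^sup>2 / v\<^sup>2) =
      (\<Sum>j\<le>m. narayana_number (Suc m) (Suc j) * (u\<^sup>2 / v\<^sup>2) ^ Suc j)"
  proof -
    have "narayana_poly (Suc m) = (\<Sum>j<Suc m. monom (narayana_number (Suc m) (Suc j)) (Suc j))"
      unfolding narayana_poly_def One_nat_def sum.atLeast1_atMost_eq by (simp only: nat.simps if_False)
    then show ?thesis
      by (simp only: poly_sum poly_monom lessThan_Suc_atMost)
  qed
  moreover have "v ^ (2 * m + 4) * (u\<^sup>2 / v\<^sup>2) ^ Suc j = u\<^sup>2 * v\<^sup>2 * (u ^ (2 * j) * v ^ (2 * (m - j)))"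
    if jm: "j \<le> m" for j
  proof -
    obtain d where d: "m = j + d" using le_Suc_ex[OF jm] by blast
    have "v ^ (2 * m + 4) = v ^ (2 * (m - j)) * v\<^sup>2 * (v\<^sup>2) ^ Suc j"
      unfolding power_mult[symmetric] power_add[symmetric] d
      by (intro arg_cong[where f = "\<lambda>n. v ^ n"]) simp
    then show ?thesis using assms
      by (simp add: power_divide power_mult)
  qed
  ultimately show ?thesis
    unfolding sum_distrib_left
    by (simp only: sum_distrib_left, intro sum.cong refl)
      (simp only: atMost_iff mult.left_commute[of "v ^ (2 * m + 4)"], simp only: mult_ac)
qed

section \<open>Moments of the Wachter law\<close>

theorem theorem6p1:
  fixes a b :: real and k :: nat
  assumes "a \<ge> 1" and "b \<ge> 1" and "k \<ge> 1"
  shows "(LINT x|wachter_law a b. x ^ k) =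
    a / (a + b) - (a + b) *
      (\<Sum>j<k - 1. (sqrt (a * (a + b - 1)) / (a + b)) ^ (2 * j + 4) *
         poly (narayana_poly (j + 1)) (b / (a * (a + b - 1))))"
proof -
  define s where "s = a + b"
  define u v where "u = sqrt b / s" and "v = sqrt (a * (a + b - 1)) / s"
  \<comment> \<open>The support has midpoint \<open>c\<close> and half-width \<open>R\<close>, and
    \<open>D\<^sup>2\<close> will be the product of the distances from its two endpoints to
    1.\<close>
  define c R e D where "c = u\<^sup>2 + v\<^sup>2" and "R = 2 * u * v" and "e = 1 - c" and "D = (b - 1) / s"
  have s: "s > 0" and ab: "a > 0" "b > 0" "a + b - 1 > 0"
    using assms by (auto simp: s_def)
  have u: "u > 0" and v: "v > 0" using s ab by (auto simp: u_def v_def)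
  have u2: "u\<^sup>2 = b / s\<^sup>2" and v2: "v\<^sup>2 = a * (s - 1) / s\<^sup>2"
    using ab by (auto simp: u_def v_def s_def power_divide)
  have R: "R > 0" using u v by (simp add: R_def)
  have D: "D \<ge> 0" using assms s by (simp add: D_def)
  have e_eq: "e = (a * b + b\<^sup>2 - b + a) / s\<^sup>2"
  proof -
    have "a * b + b\<^sup>2 - b + a = s\<^sup>2 - (b + a * (s - 1))" unfolding s_def by algebra
    then show ?thesis using s unfolding e_def c_def u2 v2
      by (simp only: diff_divide_distrib add_divide_distrib) simp
  qed
  have "b \<le> b\<^sup>2" using assms by (simp add: power2_eq_square)
  then have "0 < a * b + b\<^sup>2 - b + a" using ab mult_pos_pos[of a b] by linarith
  then have e: "e > 0" unfolding e_eq using s by simp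
  have D_eq: "D = (a * b + b\<^sup>2 - b - a) / s\<^sup>2"
  proof -
    have "a * b + b\<^sup>2 - b - a = (b - 1) * s" unfolding s_def by algebra
    then show ?thesis using s by (simp add: D_def power2_eq_square)
  qed
  have e2: "e\<^sup>2 = R\<^sup>2 + D\<^sup>2"
  proof -
    have "(a * b + b\<^sup>2 - b + a)\<^sup>2 - (a * b + b\<^sup>2 - b - a)\<^sup>2 = 4 * b * (a * (s - 1))"
      unfolding s_def by algebra
    then have "e\<^sup>2 - D\<^sup>2 = 4 * b * (a * (s - 1)) / (s\<^sup>2)\<^sup>2"
      unfolding e_eq D_eq by (simp only: power_divide diff_divide_distrib[symmetric])
    also have "\<dots> = 2\<^sup>2 * u\<^sup>2 * v\<^sup>2"
      unfolding u2 v2 by (simp add: power2_eq_square)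
    finally show ?thesis by (simp add: R_def power_mult_distrib)
  qed
  have "R\<^sup>2 \<le> e\<^sup>2" unfolding e2 by simp
  \<comment> \<open>This says that the upper endpoint \<open>c + R\<close> is at most 1.\<close>
  then have Re: "R \<le> e" by (rule power2_le_imp_le) (use e in simp)
  have "wachter_lower a b = (u - v)\<^sup>2"
    by (simp only: wachter_lower_def u_def v_def s_def diff_divide_distrib)
  then have lower: "wachter_lower a b = c - R"
    by (simp only: c_def R_def power2_diff)
  have "wachter_upper a b = (u + v)\<^sup>2"
    by (simp only: wachter_upper_def u_def v_def s_def add_divide_distrib)
  then have upper: "wachter_upper a b = c + R"
    by (simp only: c_def R_def power2_sum)
  have lower_nonneg: "c - R \<ge> 0" unfolding lower[symmetric] wachter_lower_def by simp

  define g where "g t = c - R * cos t" for t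
  \<comment> \<open>\<open>h j\<close> is the transformed integrand of the moment of order
    \<open>j + 1\<close>: one power of \<open>x\<close> cancels the \<open>x\<close> in the
    denominator of the density. The square root and \<open>dx\<close> each contribute
    \<open>R * sin t\<close>.\<close>
  define h where "h j t = s / (2 * pi) * (g t ^ j * (R\<^sup>2 * (sin t)\<^sup>2 / (1 - g t)))" for j t
  have Rcos: "\<bar>R * cos t\<bar> \<le> R" for t
    using R mult_left_mono[of "\<bar>cos t\<bar>" 1 R] by (simp add: abs_mult)
  have g_nonneg: "g t \<ge> 0" and g_le_1: "g t \<le> 1" for t
    using Rcos[of t] lower_nonneg Re unfolding g_def e_def by linarith+
  \<comment> \<open>At \<open>x = 0\<close> and \<open>x = 1\<close>, where the quotients below take the junk value \<open>0\<close>, the numerator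
    vanishes too, so no exceptional set has to be removed.\<close>
  have sin_vanishes_1: "R\<^sup>2 * (sin t)\<^sup>2 = 0" if "g t = 1" for t
  proof -
    have "R\<^sup>2 * (sin t)\<^sup>2 = - D\<^sup>2"
      using e2 that sin_cos_squared_add[of t] unfolding g_def e_def by algebra
    then show ?thesis
      by (metis neg_le_0_iff_le order_antisym zero_le_mult_iff zero_le_power2)
  qed
  have sin_vanishes_0: "R\<^sup>2 * (sin t)\<^sup>2 = 0" if "g t = 0" for t
  proof -
    have "R\<^sup>2 * (sin t)\<^sup>2 = - (u\<^sup>2 - v\<^sup>2)\<^sup>2"
      using that sin_cos_squared_add[of t] unfolding g_def c_def R_def by algebra
    then show ?thesis
      by (metis neg_le_0_iff_le order_antisym zero_le_mult_iff zero_le_power2)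
  qed

  \<comment> \<open>The induction rests on \<open>h j - h (Suc j)\<close> being free of the
    denominator \<open>1 - g t\<close>, hence a semicircle integrand.\<close>
  have h_integral: "(h j has_integral a / s - s * (\<Sum>i<j. v ^ (2 * i + 4) *
      poly (narayana_poly (Suc i)) (u\<^sup>2 / v\<^sup>2))) {0..pi}" for j
  proof (induction j)
    case 0
    have "((\<lambda>t. s / (2 * pi) * (R\<^sup>2 * (sin t)\<^sup>2 / (e + R * cos t))) has_integral
        s / (2 * pi) * (pi * (e - D))) {0..pi}"
      by (intro has_integral_mult_right has_integral_sin_squared_div R D e e2)
    also have "s / (2 * pi) * (pi * (e - D)) = a / s"
      using s unfolding e_eq D_eq by (simp add: field_simps power2_eq_square)
    finally show ?case by (simp add: h_def[abs_def] g_def e_def algebra_simps)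
  next
    case (Suc j)
    let ?S = "\<Sum>i\<le>j. narayana_number (Suc j) (Suc i) * u ^ (2 * i) * v ^ (2 * (j - i))"
    \<comment> \<open>Replacing \<open>v\<close> by \<open>- v\<close> gives the sign of the cosine
      in \<open>g\<close>; the value has only even powers of \<open>v\<close>.\<close>
    have "((\<lambda>t. (u\<^sup>2 + (- v)\<^sup>2 + 2 * u * (- v) * cos t) ^ j * (sin t)\<^sup>2) has_integral
        pi / 2 * (\<Sum>i\<le>j. narayana_number (Suc j) (Suc i) * u ^ (2 * i) * (- v) ^ (2 * (j - i)))) {0..pi}"
      by (rule has_integral_semicircle_moment)
    then have "((\<lambda>t. g t ^ j * (sin t)\<^sup>2) has_integral pi / 2 * ?S) {0..pi}"
      by (simp add: g_def c_def R_def)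
    then have "((\<lambda>t. h j t - s / (2 * pi) * R\<^sup>2 * (g t ^ j * (sin t)\<^sup>2)) has_integral
        (a / s - s * (\<Sum>i<j. v ^ (2 * i + 4) * poly (narayana_poly (Suc i)) (u\<^sup>2 / v\<^sup>2))) -
        s / (2 * pi) * R\<^sup>2 * (pi / 2 * ?S)) {0..pi}"
      by (intro has_integral_diff Suc.IH has_integral_mult_right)
    also have "s / (2 * pi) * R\<^sup>2 * (pi / 2 * ?S) = s * (u\<^sup>2 * v\<^sup>2 * ?S)"
      by (simp add: R_def power_mult_distrib)
    also have "u\<^sup>2 * v\<^sup>2 * ?S = v ^ (2 * j + 4) * poly (narayana_poly (Suc j)) (u\<^sup>2 / v\<^sup>2)"
      using narayana_poly_homogeneous[of v j u] v by simp
    also have "(\<lambda>t. h j t - s / (2 * pi) * R\<^sup>2 * (g t ^ j * (sin t)\<^sup>2)) = h (Suc j)"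
    proof
      fix t
      show "h j t - s / (2 * pi) * R\<^sup>2 * (g t ^ j * (sin t)\<^sup>2) = h (Suc j) t"
      proof (cases "g t = 1")
        case True
        then show ?thesis using sin_vanishes_1[OF True] R by (simp add: h_def)
      next
        case False
        define w where "w = R\<^sup>2 * (sin t)\<^sup>2 / (1 - g t)"
        have "R\<^sup>2 * (sin t)\<^sup>2 = w * (1 - g t)" using False by (simp add: w_def)
        then have "s / (2 * pi) * R\<^sup>2 * (g t ^ j * (sin t)\<^sup>2) = s / (2 * pi) * (g t ^ j * (w * (1 - g t)))"
          by (simp add: mult_ac)
        then show ?thesis
          unfolding h_def w_def[symmetric] by (simp add: right_diff_distrib mult_ac)
      qed
    qed
    finally show ?case by (simp add: algebra_simps)
  qed

  define F where "F x = s * sqrt ((c + R - x) * (x - (c - R))) / (2 * pi * x * (1 - x)) * x ^ k" for x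
  have F_measurable [measurable]: "F \<in> borel_measurable borel"
    unfolding F_def by measurable
  have density_F: "wachter_density a b x * x ^ k = F x * indicator {g 0..g pi} x" for x
    by (simp add: wachter_density_def F_def lower upper g_def s_def)
  have density_nonneg: "wachter_density a b x \<ge> 0" for x
  proof (cases "x \<in> {c - R..c + R}")
    case True
    then have "0 \<le> x" "x \<le> 1" using lower_nonneg Re by (auto simp: e_def)
    then show ?thesis using True s unfolding wachter_density_def lower upper
      by (auto simp: s_def)
  qed (simp add: wachter_density_def lower upper)
  have density_measurable [measurable]: "wachter_density a b \<in> borel_measurable borel"
    unfolding wachter_density_def[abs_def] by measurable
  have F_nonneg: "F x * indicator {g 0..g pi} x \<ge> 0" for x
  proof (cases "x \<ge> 0")
    case True
    then show ?thesis unfolding density_F[symmetric] by (intro mult_nonneg_nonneg density_nonneg) simp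
  next
    case False
    then have "x \<notin> {g 0..g pi}" using g_nonneg[of 0] by simp
    then show ?thesis by simp
  qed
  have subst: "F (g t) * (R * sin t) = h (k - 1) t" if t: "t \<in> {0..pi}" for t
  proof -
    obtain j where j: "k = Suc j" using assms(3) by (cases k) auto
    have "(c + R - g t) * (g t - (c - R)) = (R * sin t)\<^sup>2"
      using sin_cos_squared_add[of t] unfolding g_def by algebra
    moreover have "sin t \<ge> 0" using t by (simp add: sin_ge_zero)
    ultimately have sq: "sqrt ((c + R - g t) * (g t - (c - R))) = R * sin t"
      using R by simp
    have "F (g t) * (R * sin t) =
        s / (2 * pi) * (g t ^ k / g t * (R\<^sup>2 * (sin t)\<^sup>2 / (1 - g t)))"
      unfolding F_def sq by (simp add: power2_eq_square mult_ac)
    also have "\<dots> = h j t"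
      \<comment> \<open>For \<open>k = 1\<close> and \<open>g t = 0\<close> the factor
        \<open>g t ^ k / g t\<close> is 0 while \<open>g t ^ j\<close> is 1; the sine factor makes
        both products 0.\<close>
      using sin_vanishes_0[of t] R by (cases "g t = 0") (auto simp: h_def j)
    finally show ?thesis by (simp add: j)
  qed
  have h_nonneg: "h j t \<ge> 0" for j t
    unfolding h_def using s g_nonneg[of t] g_le_1[of t] by simp

  have "(LINT x|wachter_law a b. x ^ k) = (LINT x|lborel. F x * indicator {g 0..g pi} x)"
    unfolding wachter_law_def
    by (subst integral_density) (auto simp: density_nonneg density_F)
  \<comment> \<open>Nonnegativity moves the substitution to extended nonnegative integrals;
    finiteness then comes with the value from \<open>h_integral\<close>.\<close>
  also have "\<dots> = enn2real (\<integral>\<^sup>+ x. ennreal (F x * indicator {g 0..g pi} x) \<partial>lborel)"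
    by (rule integral_eq_nn_integral) (auto simp: F_nonneg)
  also have "(\<integral>\<^sup>+ x. ennreal (F x * indicator {g 0..g pi} x) \<partial>lborel) =
      (\<integral>\<^sup>+ t. ennreal (F (g t) * (R * sin t) * indicator {0..pi} t) \<partial>lborel)"
  proof (rule nn_integral_substitution)
    show "set_borel_measurable borel {g 0..g pi} F"
      unfolding set_borel_measurable_def by measurable
    show "(g has_real_derivative R * sin t) (at t)" for t
      unfolding g_def[abs_def] by (auto intro!: derivative_eq_intros)
    show "R * sin t \<ge> 0" if "t \<in> {0..pi}" for t
      using that R by (simp add: sin_ge_zero)
  qed (auto intro!: continuous_intros)
  also have "\<dots> = (\<integral>\<^sup>+ t. ennreal (h (k - 1) t) * indicator {0..pi} t \<partial>lborel)"
    by (intro nn_integral_cong) (simp add: subst indicator_def)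
  also have "\<dots> = ennreal (a / s - s * (\<Sum>i<k - 1. v ^ (2 * i + 4) *
      poly (narayana_poly (Suc i)) (u\<^sup>2 / v\<^sup>2)))"
    by (rule nn_integral_has_integral_lebesgue'[OF h_nonneg h_integral])
  \<comment> \<open>\<open>enn2real\<close> inverts \<open>ennreal\<close> only on nonnegative
    reals; this value qualifies as the integral of the nonnegative \<open>h (k - 1)\<close>.\<close>
  also have "enn2real \<dots> = a / s - s * (\<Sum>i<k - 1. v ^ (2 * i + 4) *
      poly (narayana_poly (Suc i)) (u\<^sup>2 / v\<^sup>2))"
    by (intro enn2real_ennreal has_integral_nonneg[OF h_integral]) (rule h_nonneg)
  also have "u\<^sup>2 / v\<^sup>2 = b / (a * (a + b - 1))"
    using s unfolding u2 v2 by (simp add: s_def)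
  finally show ?thesis by (simp add: v_def s_def)
qed

end
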